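(* Let $n\le p$, $\bm{A}=(\bm{a}_1,\ldots,\bm{a}_p)\in\mathbb{R}^{n\times p}$ of rank $n$, $\bm{b}\in\mathbb{R}^n$, $\bm{c}\in\mathbb{R}^p$, let $\bm{\xi}\in\mathbb{R}^p$ satisfy $\bm{A}\bm{\xi}=\bm{b}$, let $S>\max\{\max_{j\in[p]}\xi_j,0\}$, and $\hat{\bm{\xi}}:=\frac1S\bm{\xi}$. Consider the linear program of minimizing $f(\bm{\theta})=\hat{\bm{\xi}}^\top(\bm{c}-\bm{A}^\top\bm{\theta})$ over $\bm{\theta}\in\mathbb{R}^n$ subject to $\bm{c}-\bm{A}^\top\bm{\theta}\ge\bm{0}$. Let $\hat{p}_{\bm{x}}(\bm{\theta})=\prod_{j\in[p]}\frac{(c_j-\bm{a}_j^\top\bm{\theta})^{x_j}\exp(-(c_j-\bm{a}_j^\top\bm{\theta}))}{x_j!}$, $\bm{x}\in\{0,1,2,\ldots\}^p$, and $G(\bm{x}):=\exp\big(\sum_{j\in[p]}x_j\ln(1-\hat{\xi}_j)\big)$. Then $$f(\bm{\theta})=-\ln\mathbb{E}_{\hat{p}_{\bm{x}}(\bm{\theta})}[G(\bm{X})]\qquad\text{for all }\bm{\theta}\in\mathbb{R}^n\text{ with }\bm{c}-\bm{A}^\top\bm{\theta}>\bm{0}.$$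
   Context: $[p]:=\{1,\ldots,p\}$; vector inequalities are componentwise; $\bm{a}_j$ is the $j$-th column of $\bm{A}$. $\mathbb{E}_{\hat{p}_{\bm{x}}(\bm{\theta})}[\cdot]$ is the expectation when $\bm{X}=(X_1,\ldots,X_p)$ has probability mass $\hat{p}_{\bm{x}}(\bm{\theta})$, i.e., independent Poisson components with means $c_j-\bm{a}_j^\top\bm{\theta}$. *)

theory Defs
  imports "HOL-Probability.Probability"
begin

definition xi_hat :: "real \<Rightarrow> real ^ 'p \<Rightarrow> real ^ 'p" where
  "xi_hat S \<xi> = (1 / S) *\<^sub>R \<xi>"

definition lp_objective ::
    "real ^ 'p ^ 'n \<Rightarrow> real ^ 'p \<Rightarrow> real ^ 'p \<Rightarrow> real ^ 'n \<Rightarrow> real" where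
  "lp_objective A c w \<theta> = w \<bullet> (c - transpose A *v \<theta>)"

definition poisson_mass ::
    "real ^ 'p ^ 'n \<Rightarrow> real ^ 'p \<Rightarrow> real ^ 'n \<Rightarrow> nat ^ 'p \<Rightarrow> real" where
  "poisson_mass A c \<theta> x =
     (\<Prod>j\<in>UNIV. (c $ j - column j A \<bullet> \<theta>) ^ (x $ j) * exp (- (c $ j - column j A \<bullet> \<theta>))
                / fact (x $ j))"

text \<open>
  The distribution with mass function \<^const>\<open>poisson_mass\<close>. As \<^const>\<open>embed_pmf\<close> is only
  meaningful for normalised nonnegative functions, it is used for strictly feasible parameters
  only; the lemmas below show that it is then the intended distribution.
\<close>
definition poisson_dist ::
    "real ^ 'p ^ 'n \<Rightarrow> real ^ 'p \<Rightarrow> real ^ 'n \<Rightarrow> (nat ^ 'p) pmf" where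
  "poisson_dist A c \<theta> = embed_pmf (poisson_mass A c \<theta>)"

definition G_fun :: "real ^ 'p \<Rightarrow> nat ^ 'p \<Rightarrow> real" where
  "G_fun w x = exp (\<Sum>j\<in>UNIV. real (x $ j) * ln (1 - w $ j))"

lemma pmf_poisson_product:
  fixes A :: "real ^ 'p ^ 'n"
  assumes pos: "\<And>j. 0 < (c - transpose A *v \<theta>) $ j"
  shows "pmf (map_pmf vec_lambda (Pi_pmf UNIV 0 (\<lambda>j. poisson_pmf (c $ j - column j A \<bullet> \<theta>)))) x
    = poisson_mass A c \<theta> x"
    (is "pmf (map_pmf _ ?P) _ = _")
proof -
  have pos': "0 < c $ j - column j A \<bullet> \<theta>" for j
    using pos[of j]
    by (simp add: matrix_vector_mult_def transpose_def column_def inner_vec_def)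
  have "pmf (map_pmf vec_lambda ?P) (vec_lambda (($) x)) = pmf ?P (($) x)"
    by (rule pmf_map_inj') (simp add: inj_def vec_eq_iff fun_eq_iff)
  also have "\<dots> = poisson_mass A c \<theta> x"
    by (simp add: pmf_Pi poisson_mass_def pmf_poisson[OF pos'])
  finally show ?thesis by simp
qed

lemma poisson_dist_eq_product:
  fixes A :: "real ^ 'p ^ 'n"
  assumes pos: "\<And>j. 0 < (c - transpose A *v \<theta>) $ j"
  shows "poisson_dist A c \<theta> =
    map_pmf vec_lambda (Pi_pmf UNIV 0 (\<lambda>j. poisson_pmf (c $ j - column j A \<bullet> \<theta>)))"
  unfolding poisson_dist_def pmf_poisson_product[OF pos, symmetric]
  by (rule type_definition.Rep_inverse[OF td_pmf_embed_pmf])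

lemma pmf_poisson_dist:
  fixes A :: "real ^ 'p ^ 'n"
  assumes pos: "\<And>j. 0 < (c - transpose A *v \<theta>) $ j"
  shows "pmf (poisson_dist A c \<theta>) x = poisson_mass A c \<theta> x"
  by (simp only: poisson_dist_eq_product[OF pos] pmf_poisson_product[OF pos])

end

theory Submission
  imports Defs
begin

text \<open>
  The components of \<open>X\<close> are independent Poisson variables with means
  \<open>m\<^sub>j = c\<^sub>j - a\<^sub>j \<bullet> \<theta>\<close>, and \<open>G\<close> is the product of the powers
  \<open>(1 - w\<^sub>j) ^ X\<^sub>j\<close>, where \<open>w\<close> is the rescaled \<open>\<xi>\<close>. The probability generating function
  \<open>E[r ^ X] = exp (m (r - 1))\<close> of the Poisson distribution at \<open>r = 1 - w\<^sub>j\<close> therefore gives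
  \<open>E[G(X)] = exp (- (\<Sum>j. m\<^sub>j w\<^sub>j))\<close>. The lower bound on \<open>S\<close> ensures \<open>w\<^sub>j < 1\<close>, without which
  \<open>ln (1 - w\<^sub>j)\<close> would be a junk value.
\<close>

text \<open>With \<open>exp (- m)\<close> pulled out, this is the exponential series at
  \<open>m * r\<close>.\<close>

lemma poisson_pgf_sums:
  fixes m r :: real
  shows "(\<lambda>k. m ^ k / fact k * exp (- m) * r ^ k) sums exp (m * (r - 1))"
proof -
  have "(\<lambda>k. exp (- m) * ((m * r) ^ k /\<^sub>R fact k)) sums (exp (- m) * exp (m * r))"
    by (intro sums_mult exp_converges)
  moreover have "exp (- m) * exp (m * r) = exp (m * (r - 1))"
    by (simp add: mult_exp_exp algebra_simps)
  ultimately show ?thesis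
    by (simp add: power_mult_distrib field_simps)
qed

lemma has_bochner_integral_poisson_pgf:
  fixes m r :: real
  assumes "0 < m" "0 \<le> r"
  shows "has_bochner_integral (measure_pmf (poisson_pmf m)) (\<lambda>k. r ^ k) (exp (m * (r - 1)))"
proof -
  let ?f = "\<lambda>k. m ^ k / fact k * exp (- m) * r ^ k"
  \<comment> \<open>All terms are nonnegative, so convergence is absolute, as integrability over
    \<open>count_space\<close> requires.\<close>
  have "summable (\<lambda>k. norm (?f k))"
    using poisson_pgf_sums[of m r] assms by (simp add: sums_iff abs_mult)
  then have int: "integrable (count_space UNIV) ?f"
    by (simp only: integrable_count_space_nat_iff)
  then have "integral\<^sup>L (count_space UNIV) ?f = exp (m * (r - 1))"
    using poisson_pgf_sums[of m r] by (simp add: integral_count_space_nat sums_iff)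
  with int have "has_bochner_integral (count_space UNIV) ?f (exp (m * (r - 1)))"
    by (simp only: has_bochner_integral_iff simp_thms)
  then show ?thesis
    unfolding measure_pmf_eq_density using assms
    by (intro has_bochner_integral_density) (auto simp: mult_ac)
qed

lemma G_fun_eq_prod:
  assumes "\<And>j. w $ j < 1"
  shows "G_fun w x = (\<Prod>j\<in>UNIV. (1 - w $ j) ^ (x $ j))"
  using assms by (simp add: G_fun_def exp_sum exp_of_nat_mult)

lemma has_bochner_integral_G_fun:
  fixes A :: "real ^ 'p ^ 'n"
  assumes pos: "\<And>j. 0 < (c - transpose A *v \<theta>) $ j" and w: "\<And>j. w $ j < 1"
  shows "has_bochner_integral (measure_pmf (poisson_dist A c \<theta>)) (G_fun w)
    (exp (- lp_objective A c w \<theta>))"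
proof -
  define m where "m j = c $ j - column j A \<bullet> \<theta>" for j
  have m_eq: "(c - transpose A *v \<theta>) $ j = m j" for j
    by (simp add: m_def matrix_vector_mult_def transpose_def column_def inner_vec_def)
  have m_pos: "0 < m j" for j
    using pos[of j] by (simp only: m_eq)
  let ?P = "Pi_pmf UNIV 0 (\<lambda>j. poisson_pmf (m j))"
  let ?g = "\<lambda>h. \<Prod>j\<in>UNIV. (1 - w $ j) ^ h j"
  have r_nonneg: "0 \<le> 1 - w $ j" for j
    using w[of j] by simp
  have pgf: "has_bochner_integral (measure_pmf (poisson_pmf (m j))) (\<lambda>k. (1 - w $ j) ^ k)
      (exp (m j * (1 - w $ j - 1)))" for j
    by (rule has_bochner_integral_poisson_pgf[OF m_pos r_nonneg])
  have int: "integrable (measure_pmf ?P) ?g"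
    by (intro integrable_prod_Pi_pmf) (auto intro: integrable.intros[OF pgf])
  \<comment> \<open>Independence: under \<open>Pi_pmf\<close> the expectation of a product of
    one-coordinate functions factors.\<close>
  have "measure_pmf.expectation ?P ?g
      = (\<Prod>j\<in>UNIV. measure_pmf.expectation (poisson_pmf (m j)) (\<lambda>k. (1 - w $ j) ^ k))"
    using r_nonneg
    by (intro expectation_prod_Pi_pmf) (auto intro: integrable.intros[OF pgf])
  also have "\<dots> = (\<Prod>j\<in>UNIV. exp (- (w $ j * m j)))"
    by (simp add: has_bochner_integral_integral_eq[OF pgf] mult.commute)
  also have "\<dots> = exp (- lp_objective A c w \<theta>)"
    unfolding lp_objective_def inner_vec_def m_eq by (simp add: exp_sum sum_negf[symmetric])
  finally have exp_eq: "measure_pmf.expectation ?P ?g = exp (- lp_objective A c w \<theta>)" .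
  have dist: "poisson_dist A c \<theta> = map_pmf vec_lambda ?P"
    unfolding m_def by (rule poisson_dist_eq_product[OF pos])
  have "G_fun w = (\<lambda>x. \<Prod>j\<in>UNIV. (1 - w $ j) ^ (x $ j))"
    using w by (intro ext G_fun_eq_prod)
  \<comment> \<open>Pulled back along \<open>vec_lambda\<close>, \<open>G_fun w\<close> becomes
    \<open>?g\<close>, so the facts about \<open>?P\<close> transfer.\<close>
  with int exp_eq show ?thesis
    by (simp add: dist has_bochner_integral_iff)
qed

text \<open>Since \<open>S > 0\<close>, the bound \<open>\<xi> $ j < S\<close> may be divided by
  \<open>S\<close>.\<close>

lemma xi_hat_less_1:
  fixes \<xi> :: "real ^ 'p"
  assumes "S > max (Max (range (\<lambda>j. \<xi> $ j))) 0"
  shows "xi_hat S \<xi> $ j < 1"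
proof -
  have "\<xi> $ j \<le> Max (range (\<lambda>j. \<xi> $ j))"
    by (intro Max_ge) auto
  with assms show ?thesis
    by (simp add: xi_hat_def)
qed

text \<open>The integrability conjunct ensures that the expectation is not the default value 0 of a
  non-integrable function.\<close>

theorem corollaryB2:
  fixes A :: "real ^ 'p ^ 'n"
    and b :: "real ^ 'n"
    and c \<xi> :: "real ^ 'p"
    and S :: real
  assumes "CARD('n) \<le> CARD('p)"
    and "rank A = CARD('n)"
    and "A *v \<xi> = b"
    and "S > max (Max (range (\<lambda>j. \<xi> $ j))) 0"
  shows "\<forall>\<theta> :: real ^ 'n. (\<forall>j. (c - transpose A *v \<theta>) $ j > 0) \<longrightarrow>
    integrable (measure_pmf (poisson_dist A c \<theta>)) (G_fun (xi_hat S \<xi>)) \<and>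
    lp_objective A c (xi_hat S \<xi>) \<theta> =
      - ln (measure_pmf.expectation (poisson_dist A c \<theta>) (G_fun (xi_hat S \<xi>)))"
proof (intro allI impI)
  fix \<theta> :: "real ^ 'n"
  assume "\<forall>j. (c - transpose A *v \<theta>) $ j > 0"
  then have "has_bochner_integral (measure_pmf (poisson_dist A c \<theta>)) (G_fun (xi_hat S \<xi>))
      (exp (- lp_objective A c (xi_hat S \<xi>) \<theta>))"
    using assms(4) by (intro has_bochner_integral_G_fun xi_hat_less_1) auto
  then show "integrable (measure_pmf (poisson_dist A c \<theta>)) (G_fun (xi_hat S \<xi>)) \<and>
      lp_objective A c (xi_hat S \<xi>) \<theta> =
        - ln (measure_pmf.expectation (poisson_dist A c \<theta>) (G_fun (xi_hat S \<xi>)))"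
    by (simp add: has_bochner_integral_iff)
qed

end
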